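(* Let $u$, $u_n$, $n=1,2,\ldots$, be fuzzy sets in $F^1_{USC}(X)$. (i) $H_{\rm send}(u_n,u)\to0$ if and only if $H_{\rm end}(u_n,u)\to0$ and $H([u_n]_0,[u]_0)\to0$. (ii) $\lim^{(K)}_{n\to\infty}{\rm send}\,u_n={\rm send}\,u$ if and only if $\lim^{(\Gamma)}_{n\to\infty}u_n=u$ and $\lim^{(K)}_{n\to\infty}[u_n]_0=[u]_0$.
   Context: $(X,d)$ is a nonempty metric space. $X\times[0,1]$ carries the metric $\overline d((x,\alpha),(y,\beta))=d(x,y)+|\alpha-\beta|$. A fuzzy set in $X$ is a function $u:X\to[0,1]$, with $\alpha$-cuts $[u]_\alpha=\{x\in X: u(x)\ge\alpha\}$ for $\alpha\in(0,1]$ and $[u]_0=\overline{\{x\in X:u(x)>0\}}$. $F^1_{USC}(X)$ is the set of fuzzy sets $u$ in $X$ such that $[u]_\alpha$ is nonempty and closed for all $\alpha\in[0,1]$. For nonempty closed sets $A,B$, $H(A,B)=\max\{\sup_{a\in A}\inf_{b\in B}\rho(a,b),\sup_{b\in B}\inf_{a\in A}\rho(a,b)\}\in[0,+\infty]$ is the Hausdorff distance, with $\rho=d$ on $X$ and $\rho=\overline d$ on $X\times[0,1]$. ${\rm end}\,u=\{(x,t)\in X\times[0,1]:u(x)\ge t\}$; ${\rm send}\,u={\rm end}\,u\cap([u]_0\times[0,1])$; $H_{\rm end}(u,v)=H({\rm end}\,u,{\rm end}\,v)$; $H_{\rm send}(u,v)=H({\rm send}\,u,{\rm send}\,v)$.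 A sequence of sets $\{C_n\}$ in a metric space $Y$ Kuratowski converges to $C\subseteq Y$, written $C=\lim^{(K)}_{n\to\infty}C_n$, if $C=\liminf_{n\to\infty}C_n=\limsup_{n\to\infty}C_n$, where $\liminf_n C_n=\{x\in Y: x=\lim_n x_n,\ x_n\in C_n\}$ and $\limsup_n C_n=\{x\in Y: x=\lim_j x_{n_j},\ x_{n_j}\in C_{n_j}\text{ for some subsequence}\}$. The $\Gamma$-convergence $u=\lim^{(\Gamma)}_{n\to\infty}u_n$ means ${\rm end}\,u=\lim^{(K)}_{n\to\infty}{\rm end}\,u_n$ in $(X\times[0,1],\overline d)$. *)

theory Defs
  imports "HOL-Analysis.Analysis"
begin

section \<open>Hausdorff distance and Kuratowski convergence in a metric space\<close>

definition hausdorff_edist :: "'b metric \<Rightarrow> 'b set \<Rightarrow> 'b set \<Rightarrow> ennreal" where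
  "hausdorff_edist Y A B =
     max (SUP a\<in>A. INF b\<in>B. ennreal (mdist Y a b)) (SUP b\<in>B. INF a\<in>A. ennreal (mdist Y a b))"

definition kuratowski_liminf :: "'b metric \<Rightarrow> (nat \<Rightarrow> 'b set) \<Rightarrow> 'b set" where
  "kuratowski_liminf Y C =
     {y. \<exists>s. (\<forall>n. s n \<in> C n) \<and> limitin (mtopology_of Y) s y sequentially}"

definition kuratowski_limsup :: "'b metric \<Rightarrow> (nat \<Rightarrow> 'b set) \<Rightarrow> 'b set" where
  "kuratowski_limsup Y C =
     {y. \<exists>(r :: nat \<Rightarrow> nat) s. strict_mono r \<and> (\<forall>j. s j \<in> C (r j)) \<and>
           limitin (mtopology_of Y) s y sequentially}"

definition kuratowski_converges :: "'b metric \<Rightarrow> (nat \<Rightarrow> 'b set) \<Rightarrow> 'b set \<Rightarrow> bool" where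
  "kuratowski_converges Y C L \<longleftrightarrow> L = kuratowski_liminf Y C \<and> L = kuratowski_limsup Y C"

section \<open>The metric space of pairs over the unit interval\<close>

text \<open>The library's \<^const>\<open>prod_metric\<close> is the Euclidean combination of the two metrics;
  here the sum is required.\<close>

definition cylinder_metric :: "'a metric \<Rightarrow> ('a \<times> real) metric" where
  "cylinder_metric X =
     metric (mspace X \<times> {0..1}, \<lambda>(x, \<alpha>) (y, \<beta>). mdist X x y + \<bar>\<alpha> - \<beta>\<bar>)"

lemma Metric_space_cylinder:
  "Metric_space (mspace X \<times> {0..1::real}) (\<lambda>(x, \<alpha>) (y, \<beta>). mdist X x y + \<bar>\<alpha> - \<beta>\<bar>)"
proof
  show "0 \<le> (case p of (x, \<alpha>) \<Rightarrow> \<lambda>(y, \<beta>). mdist X x y + \<bar>\<alpha> - \<beta>\<bar>) q" for p q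
    by (auto split: prod.splits)
  show "(case p of (x, \<alpha>) \<Rightarrow> \<lambda>(y, \<beta>). mdist X x y + \<bar>\<alpha> - \<beta>\<bar>) q =
        (case q of (x, \<alpha>) \<Rightarrow> \<lambda>(y, \<beta>). mdist X x y + \<bar>\<alpha> - \<beta>\<bar>) p" for p q
    by (auto split: prod.splits simp: mdist_commute)
  show "((case p of (x, \<alpha>) \<Rightarrow> \<lambda>(y, \<beta>). mdist X x y + \<bar>\<alpha> - \<beta>\<bar>) q = 0) = (p = q)"
    if "p \<in> mspace X \<times> {0..1::real}" "q \<in> mspace X \<times> {0..1}" for p q
    using that by (auto split: prod.splits simp: add_nonneg_eq_0_iff)
  show "(case p of (x, \<alpha>) \<Rightarrow> \<lambda>(y, \<beta>). mdist X x y + \<bar>\<alpha> - \<beta>\<bar>) r \<le>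
        (case p of (x, \<alpha>) \<Rightarrow> \<lambda>(y, \<beta>). mdist X x y + \<bar>\<alpha> - \<beta>\<bar>) q +
        (case q of (x, \<alpha>) \<Rightarrow> \<lambda>(y, \<beta>). mdist X x y + \<bar>\<alpha> - \<beta>\<bar>) r"
    if "p \<in> mspace X \<times> {0..1::real}" "q \<in> mspace X \<times> {0..1}" "r \<in> mspace X \<times> {0..1}" for p q r
  proof -
    obtain x a y b z c where "p = (x, a)" "q = (y, b)" "r = (z, c)"
      by (metis surj_pair)
    with that show ?thesis
      using mdist_triangle[of x X y z] by auto
  qed
qed

lemma mspace_cylinder [simp]: "mspace (cylinder_metric X) = mspace X \<times> {0..1}"
  by (simp add: cylinder_metric_def Metric_space.mspace_metric[OF Metric_space_cylinder])

lemma mdist_cylinder [simp]: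
  "mdist (cylinder_metric X) (x, \<alpha>) (y, \<beta>) = mdist X x y + \<bar>\<alpha> - \<beta>\<bar>"
  by (simp add: cylinder_metric_def Metric_space.mdist_metric[OF Metric_space_cylinder])

section \<open>Fuzzy sets\<close>

text \<open>A fuzzy set in \<open>X\<close> is represented by a total function into the reals that maps
  \<^term>\<open>mspace X\<close> into the unit interval. All notions below depend only on its values on
  \<^term>\<open>mspace X\<close>.\<close>

definition fuzzy_sets :: "'a metric \<Rightarrow> ('a \<Rightarrow> real) set" where
  "fuzzy_sets X = mspace X \<rightarrow> {0..1}"

definition alpha_cut :: "'a metric \<Rightarrow> ('a \<Rightarrow> real) \<Rightarrow> real \<Rightarrow> 'a set" where
  "alpha_cut X u \<alpha> =
     (if \<alpha> = 0 then mtopology_of X closure_of {x \<in> mspace X. u x > 0}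
      else {x \<in> mspace X. u x \<ge> \<alpha>})"

definition F1_USC :: "'a metric \<Rightarrow> ('a \<Rightarrow> real) set" where
  "F1_USC X =
     {u \<in> fuzzy_sets X.
        \<forall>\<alpha>\<in>{0..1}. alpha_cut X u \<alpha> \<noteq> {} \<and> closedin (mtopology_of X) (alpha_cut X u \<alpha>)}"

definition endograph :: "'a metric \<Rightarrow> ('a \<Rightarrow> real) \<Rightarrow> ('a \<times> real) set" where
  "endograph X u = {(x, t). x \<in> mspace X \<and> t \<in> {0..1} \<and> u x \<ge> t}"

definition sendograph :: "'a metric \<Rightarrow> ('a \<Rightarrow> real) \<Rightarrow> ('a \<times> real) set" where
  "sendograph X u = endograph X u \<inter> (alpha_cut X u 0 \<times> {0..1})"

definition H_end :: "'a metric \<Rightarrow> ('a \<Rightarrow> real) \<Rightarrow> ('a \<Rightarrow> real) \<Rightarrow> ennreal" where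
  "H_end X u v = hausdorff_edist (cylinder_metric X) (endograph X u) (endograph X v)"

definition H_send :: "'a metric \<Rightarrow> ('a \<Rightarrow> real) \<Rightarrow> ('a \<Rightarrow> real) \<Rightarrow> ennreal" where
  "H_send X u v = hausdorff_edist (cylinder_metric X) (sendograph X u) (sendograph X v)"

definition gamma_converges :: "'a metric \<Rightarrow> (nat \<Rightarrow> 'a \<Rightarrow> real) \<Rightarrow> ('a \<Rightarrow> real) \<Rightarrow> bool" where
  "gamma_converges X un u \<longleftrightarrow>
     kuratowski_converges (cylinder_metric X) (\<lambda>n. endograph X (un n)) (endograph X u)"

end

theory Submission
  imports Defs
begin

text \<open>The sendograph and the endograph of a fuzzy set differ only at height \<open>0\<close>: at positive
  heights they contain the same points, while the bottom of the sendograph is the \<open>0\<close>-cut and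
  the bottom of the endograph is the whole space. Convergence at positive heights is therefore
  the same question for both, at the bottom it is trivial for endographs, and for sendographs
  it is convergence of the \<open>0\<close>-cuts.

  For the Hausdorff distance this gives three inequalities, valid for any two fuzzy sets: the
  distances between endographs and between \<open>0\<close>-cuts are each at most the distance between
  sendographs, which in turn is at most their sum. The one step that needs an argument is that
  a sendograph point \<open>(x, t)\<close> may be approximated in the other endograph by a point \<open>(y, 0)\<close>
  with \<open>y\<close> outside the \<open>0\<close>-cut; then \<open>t\<close> itself is small, so that \<open>(x, t)\<close> can be compared with
  a bottom point above the other \<open>0\<close>-cut.

  For Kuratowski convergence the same dichotomy is applied to limits, which in the cylinder
  are taken coordinatewise: a sequence with a limit at positive height eventually has positive
  height and so moves freely between endographs and sendographs.\<close>

section \<open>Endographs and sendographs\<close>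

lemma alpha_cut_0_subset: "alpha_cut X u 0 \<subseteq> mspace X"
  using closure_of_subset_topspace[of "mtopology_of X"] by (auto simp: alpha_cut_def)

lemma pos_in_alpha_cut_0:
  assumes "x \<in> mspace X" "u x > 0"
  shows "x \<in> alpha_cut X u 0"
  using assms closure_of_subset[of "{x \<in> mspace X. u x > 0}" "mtopology_of X"]
  by (auto simp: alpha_cut_def)

lemma endograph_subset_cylinder: "endograph X u \<subseteq> mspace X \<times> {0..1}"
  by (auto simp: endograph_def)

lemma sendograph_subset_endograph: "sendograph X u \<subseteq> endograph X u"
  by (auto simp: sendograph_def)

lemma sendograph_fst: "p \<in> sendograph X u \<Longrightarrow> fst p \<in> alpha_cut X u 0"
  by (auto simp: sendograph_def)

lemma endograph_pos_in_sendograph: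
  assumes "p \<in> endograph X u" "snd p > 0"
  shows "p \<in> sendograph X u"
  using assms by (auto simp: sendograph_def endograph_def intro: pos_in_alpha_cut_0)

lemma bottom_in_endograph:
  assumes "u \<in> fuzzy_sets X" "x \<in> mspace X"
  shows "(x, 0) \<in> endograph X u"
  using assms by (auto simp: fuzzy_sets_def endograph_def)

lemma bottom_in_sendograph:
  assumes "u \<in> fuzzy_sets X" "x \<in> alpha_cut X u 0"
  shows "(x, 0) \<in> sendograph X u"
  using assms alpha_cut_0_subset[of X u] bottom_in_endograph[of u X x]
  by (auto simp: sendograph_def)

section \<open>Hausdorff distances\<close>

text \<open>The Hausdorff distance is symmetric but its estimates are not: they concern approximating
  a point of one set by points of the other. The comparisons below are therefore made for this
  one-sided distance and pass to the maximum of the two directions.\<close>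

definition excess :: "'b metric \<Rightarrow> 'b set \<Rightarrow> 'b set \<Rightarrow> ennreal" where
  "excess Y A B = (SUP a\<in>A. INF b\<in>B. ennreal (mdist Y a b))"

lemma hausdorff_edist_eq_excess: "hausdorff_edist Y A B = max (excess Y A B) (excess Y B A)"
  by (simp add: hausdorff_edist_def excess_def mdist_commute)

lemma point_le_excess: "a \<in> A \<Longrightarrow> (INF b\<in>B. ennreal (mdist Y a b)) \<le> excess Y A B"
  unfolding excess_def by (rule SUP_upper)

lemma excess_alpha_cut_le_send:
  assumes "u \<in> fuzzy_sets X"
  shows "excess X (alpha_cut X u 0) (alpha_cut X v 0)
           \<le> excess (cylinder_metric X) (sendograph X u) (sendograph X v)"
  unfolding excess_def
proof (rule SUP_mono)
  fix x assume "x \<in> alpha_cut X u 0"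
  then have "(x, 0) \<in> sendograph X u" by (rule bottom_in_sendograph[OF assms])
  moreover have "(INF y\<in>alpha_cut X v 0. ennreal (mdist X x y))
      \<le> (INF q\<in>sendograph X v. ennreal (mdist (cylinder_metric X) (x, 0) q))"
  proof (rule INF_mono)
    fix q assume q: "q \<in> sendograph X v"
    have "mdist X x (fst q) \<le> mdist (cylinder_metric X) (x, 0) q"
      by (cases q) simp
    then show "\<exists>y\<in>alpha_cut X v 0.
        ennreal (mdist X x y) \<le> ennreal (mdist (cylinder_metric X) (x, 0) q)"
      using sendograph_fst[OF q] ennreal_leI by blast
  qed
  ultimately show "\<exists>p\<in>sendograph X u. (INF y\<in>alpha_cut X v 0. ennreal (mdist X x y))
      \<le> (INF q\<in>sendograph X v. ennreal (mdist (cylinder_metric X) p q))"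
    by blast
qed

text \<open>Endograph points of positive height already lie in the sendograph, and bottom points,
  being common to all endographs, have distance \<open>0\<close> to the other endograph.\<close>

lemma excess_end_le_send:
  assumes "v \<in> fuzzy_sets X"
  shows "excess (cylinder_metric X) (endograph X u) (endograph X v)
           \<le> excess (cylinder_metric X) (sendograph X u) (sendograph X v)"
  unfolding excess_def[of _ "endograph X u"]
proof (rule SUP_least)
  fix p assume p: "p \<in> endograph X u"
  show "(INF q\<in>endograph X v. ennreal (mdist (cylinder_metric X) p q))
      \<le> excess (cylinder_metric X) (sendograph X u) (sendograph X v)"
  proof (cases "snd p > 0")
    case True
    have "(INF q\<in>endograph X v. ennreal (mdist (cylinder_metric X) p q))
        \<le> (INF q\<in>sendograph X v. ennreal (mdist (cylinder_metric X) p q))"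
      by (rule INF_superset_mono[OF sendograph_subset_endograph]) simp
    also have "\<dots> \<le> excess (cylinder_metric X) (sendograph X u) (sendograph X v)"
      by (rule point_le_excess[OF endograph_pos_in_sendograph[OF p True]])
    finally show ?thesis .
  next
    case False
    then have "p \<in> endograph X v"
      using p bottom_in_endograph[OF assms, of "fst p"] by (auto simp: endograph_def)
    then have "(INF q\<in>endograph X v. ennreal (mdist (cylinder_metric X) p q))
        \<le> ennreal (mdist (cylinder_metric X) p p)"
      by (rule INF_lower)
    also have "mdist (cylinder_metric X) p p = 0"
      using p by (auto simp: endograph_def)
    finally show ?thesis by simp
  qed
qed

lemma INF_add_const_ennreal:
  fixes f :: "'b \<Rightarrow> ennreal"
  assumes "I \<noteq> {}"
  shows "(INF i\<in>I. f i + c) = (INF i\<in>I. f i) + c"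
  using continuous_at_Inf_mono[of "\<lambda>x. x + c" "f ` I"] assms
    continuous_add[of "at_right (Inf (f ` I))" "\<lambda>x. x" "\<lambda>x. c"]
  by (auto simp: mono_def image_comp)

lemma le_INF_add_INF_ennreal:
  fixes f :: "'b \<Rightarrow> ennreal" and g :: "'c \<Rightarrow> ennreal"
  assumes "\<And>i j. i \<in> I \<Longrightarrow> j \<in> J \<Longrightarrow> c \<le> f i + g j"
  shows "c \<le> (INF i\<in>I. f i) + (INF j\<in>J. g j)"
proof (cases "I = {} \<or> J = {}")
  case False
  have "c \<le> (INF i\<in>I. f i + g j)" if "j \<in> J" for j
    by (intro INF_greatest assms that)
  then have "c \<le> (INF i\<in>I. f i) + g j" if "j \<in> J" for j
    using False INF_add_const_ennreal[of I f "g j"] that by metis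
  then have "c \<le> (INF j\<in>J. g j + (INF i\<in>I. f i))"
    by (intro INF_greatest) (simp add: add.commute)
  then show ?thesis
    using False by (simp add: INF_add_const_ennreal add.commute)
qed auto

text \<open>Let \<open>(x, t)\<close> be a sendograph point of \<open>u\<close> and \<open>(y, s)\<close> an endograph point of \<open>v\<close>
  approximating it. Then \<open>(y, s)\<close> lies in the sendograph of \<open>v\<close> unless \<open>s = 0\<close>. In that
  exceptional case \<open>t\<close> is bounded by the distance to \<open>(y, s)\<close>, and \<open>(z, 0)\<close>, with \<open>z\<close> a point of
  the \<open>0\<close>-cut of \<open>v\<close> approximating \<open>x\<close>, serves instead.\<close>

lemma excess_send_le_end_plus_alpha_cut:
  assumes "v \<in> fuzzy_sets X"
  shows "excess (cylinder_metric X) (sendograph X u) (sendograph X v)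
           \<le> excess (cylinder_metric X) (endograph X u) (endograph X v)
             + excess X (alpha_cut X u 0) (alpha_cut X v 0)"
  unfolding excess_def[of _ "sendograph X u"]
proof (rule SUP_least)
  let ?Y = "cylinder_metric X"
  fix p assume p: "p \<in> sendograph X u"
  let ?c = "INF q\<in>sendograph X v. ennreal (mdist ?Y p q)"
  obtain x t where [simp]: "p = (x, t)" by (cases p)
  have t: "t \<ge> 0" using p by (auto simp: sendograph_def)
  have "?c \<le> ennreal (mdist ?Y p q) + ennreal (mdist X x z)"
    if q: "q \<in> endograph X v" and z: "z \<in> alpha_cut X v 0" for q z
  proof (cases "snd q > 0")
    case True
    have "?c \<le> ennreal (mdist ?Y p q)"
      by (rule INF_lower[OF endograph_pos_in_sendograph[OF q True]])
    then show ?thesis by (rule order_trans) simp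
  next
    case False
    then have "snd q = 0" using q by (auto simp: endograph_def)
    then have *: "mdist ?Y p (z, 0) \<le> mdist ?Y p q + mdist X x z"
      using t by (cases q) simp
    have "?c \<le> ennreal (mdist ?Y p (z, 0))"
      by (rule INF_lower[OF bottom_in_sendograph[OF assms z]])
    also have "\<dots> \<le> ennreal (mdist ?Y p q) + ennreal (mdist X x z)"
      using ennreal_leI[OF *] by (simp add: ennreal_plus del: mdist_cylinder)
    finally show ?thesis .
  qed
  then have "?c \<le> (INF q\<in>endograph X v. ennreal (mdist ?Y p q))
                 + (INF z\<in>alpha_cut X v 0. ennreal (mdist X x z))"
    by (rule le_INF_add_INF_ennreal)
  also have "\<dots> \<le> excess ?Y (endograph X u) (endograph X v)
      + excess X (alpha_cut X u 0) (alpha_cut X v 0)"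
    using p sendograph_subset_endograph[of X u] sendograph_fst[OF p]
    by (intro add_mono point_le_excess) auto
  finally show "?c \<le> excess ?Y (endograph X u) (endograph X v)
      + excess X (alpha_cut X u 0) (alpha_cut X v 0)" .
qed

lemma H_alpha_cut_le_H_send:
  assumes "u \<in> fuzzy_sets X" "v \<in> fuzzy_sets X"
  shows "hausdorff_edist X (alpha_cut X u 0) (alpha_cut X v 0) \<le> H_send X u v"
  unfolding H_send_def hausdorff_edist_eq_excess
  by (intro max.mono excess_alpha_cut_le_send assms)

lemma H_end_le_H_send:
  assumes "u \<in> fuzzy_sets X" "v \<in> fuzzy_sets X"
  shows "H_end X u v \<le> H_send X u v"
  unfolding H_send_def H_end_def hausdorff_edist_eq_excess
  by (intro max.mono excess_end_le_send assms)

lemma H_send_le_H_end_plus_H_alpha_cut: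
  assumes "u \<in> fuzzy_sets X" "v \<in> fuzzy_sets X"
  shows "H_send X u v \<le> H_end X u v + hausdorff_edist X (alpha_cut X u 0) (alpha_cut X v 0)"
  unfolding H_send_def H_end_def hausdorff_edist_eq_excess
  by (intro max.boundedI order_trans[OF excess_send_le_end_plus_alpha_cut] add_mono assms) auto

lemma tendsto_0_le_ennreal:
  fixes f g :: "'b \<Rightarrow> ennreal"
  assumes "(g \<longlongrightarrow> 0) F" "\<And>n. f n \<le> g n"
  shows "(f \<longlongrightarrow> 0) F"
  by (rule tendsto_sandwich[OF _ _ tendsto_const assms(1)]) (simp_all add: assms(2))

theorem H_send_tendsto_0_iff:
  assumes "u \<in> fuzzy_sets X" "\<And>n. un n \<in> fuzzy_sets X"
  shows "((\<lambda>n. H_send X (un n) u) \<longlonglongrightarrow> 0) \<longleftrightarrow>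
         ((\<lambda>n. H_end X (un n) u) \<longlonglongrightarrow> 0) \<and>
         ((\<lambda>n. hausdorff_edist X (alpha_cut X (un n) 0) (alpha_cut X u 0)) \<longlonglongrightarrow> 0)"
    (is "?S \<longleftrightarrow> ?E \<and> ?C")
proof (intro iffI conjI)
  assume ?S
  then show ?E
    by (rule tendsto_0_le_ennreal) (intro H_end_le_H_send assms)
  from \<open>?S\<close> show ?C
    by (rule tendsto_0_le_ennreal) (intro H_alpha_cut_le_H_send assms)
next
  assume "?E \<and> ?C"
  then have "(\<lambda>n. H_end X (un n) u
      + hausdorff_edist X (alpha_cut X (un n) 0) (alpha_cut X u 0)) \<longlonglongrightarrow> 0"
    using tendsto_add[of _ 0 sequentially _ 0] by fastforce
  then show ?S
    by (rule tendsto_0_le_ennreal) (intro H_send_le_H_end_plus_H_alpha_cut assms)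
qed

section \<open>Kuratowski convergence\<close>

lemma kuratowski_liminfI:
  assumes "\<And>n. s n \<in> C n" "limitin (mtopology_of Y) s y sequentially"
  shows "y \<in> kuratowski_liminf Y C"
  using assms by (auto simp: kuratowski_liminf_def)

lemma kuratowski_limsupI:
  assumes "strict_mono r" "\<And>j. s j \<in> C (r j)" "limitin (mtopology_of Y) s y sequentially"
  shows "y \<in> kuratowski_limsup Y C"
  using assms by (auto simp: kuratowski_limsup_def)

lemma kuratowski_liminf_subset_limsup: "kuratowski_liminf Y C \<subseteq> kuratowski_limsup Y C"
  unfolding kuratowski_liminf_def kuratowski_limsup_def
  using strict_mono_id by fastforce

lemma kuratowski_converges_iff:
  "kuratowski_converges Y C L \<longleftrightarrow> L \<subseteq> kuratowski_liminf Y C \<and> kuratowski_limsup Y C \<subseteq> L"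
  using kuratowski_liminf_subset_limsup[of Y C] by (auto simp: kuratowski_converges_def)

lemma limitin_mtopology_of_dist_null:
  "limitin (mtopology_of Y) s y F \<longleftrightarrow>
     y \<in> mspace Y \<and> (\<forall>\<^sub>F n in F. s n \<in> mspace Y) \<and> ((\<lambda>n. mdist Y (s n) y) \<longlongrightarrow> 0) F"
  unfolding mtopology_of_def
  by (rule Metric_space.limitin_metric_dist_null[OF Metric_space_mspace_mdist])

lemma limitin_cylinder_iff:
  assumes "\<And>n. s n \<in> mspace X \<times> {0..1}" "F \<noteq> bot"
  shows "limitin (mtopology_of (cylinder_metric X)) s (x, t) F \<longleftrightarrow>
         limitin (mtopology_of X) (\<lambda>n. fst (s n)) x F \<and> ((\<lambda>n. snd (s n)) \<longlongrightarrow> t) F"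
    (is "?L \<longleftrightarrow> ?A \<and> ?B")
proof
  have eq: "mdist (cylinder_metric X) (s n) (x, t) = mdist X (fst (s n)) x + \<bar>snd (s n) - t\<bar>" for n
    by (cases "s n") simp
  have in_X: "fst (s n) \<in> mspace X" for n
    using assms(1)[of n] by auto
  {
    assume L: ?L
    then have lim: "((\<lambda>n. mdist X (fst (s n)) x + \<bar>snd (s n) - t\<bar>) \<longlongrightarrow> 0) F" and x: "x \<in> mspace X"
      by (auto simp: limitin_mtopology_of_dist_null eq)
    have "((\<lambda>n. mdist X (fst (s n)) x) \<longlongrightarrow> 0) F"
      by (rule tendsto_sandwich[OF _ _ tendsto_const lim]) auto
    moreover have "((\<lambda>n. \<bar>snd (s n) - t\<bar>) \<longlongrightarrow> 0) F"
      by (rule tendsto_sandwich[OF _ _ tendsto_const lim]) auto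
    ultimately show "?A \<and> ?B"
      using x in_X by (simp add: limitin_mtopology_of_dist_null tendsto_rabs_zero_iff LIM_zero_iff)
  }
  {
    assume AB: "?A \<and> ?B"
    have "snd (s n) \<in> {0..1}" for n
      using assms(1)[of n] by auto
    then have "t \<in> {0..1}"
      using AB assms(2) by (intro Lim_in_closed_set[of "{0..1}" "\<lambda>n. snd (s n)" F]) auto
    moreover have "((\<lambda>n. mdist X (fst (s n)) x + \<bar>snd (s n) - t\<bar>) \<longlongrightarrow> 0 + 0) F"
      using AB by (intro tendsto_add)
        (auto simp: limitin_mtopology_of_dist_null tendsto_rabs_zero_iff LIM_zero_iff)
    ultimately show ?L
      using AB assms(1) by (simp add: limitin_mtopology_of_dist_null eq)
  }
qed

lemmas limitin_endographs_iff =
  limitin_cylinder_iff[OF subsetD[OF endograph_subset_cylinder] sequentially_bot]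

lemmas limitin_sendographs_iff =
  limitin_endographs_iff[OF subsetD[OF sendograph_subset_endograph]]

lemma liminf_sendograph_subset_endograph:
  "kuratowski_liminf (cylinder_metric X) (\<lambda>n. sendograph X (un n))
     \<subseteq> kuratowski_liminf (cylinder_metric X) (\<lambda>n. endograph X (un n))"
  using sendograph_subset_endograph by (fastforce simp: kuratowski_liminf_def)

lemma limsup_sendograph_subset_endograph:
  "kuratowski_limsup (cylinder_metric X) (\<lambda>n. sendograph X (un n))
     \<subseteq> kuratowski_limsup (cylinder_metric X) (\<lambda>n. endograph X (un n))"
  using sendograph_subset_endograph unfolding kuratowski_limsup_def by blast

lemma fst_liminf_sendograph:
  assumes "(x, t) \<in> kuratowski_liminf (cylinder_metric X) (\<lambda>n. sendograph X (un n))"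
  shows "x \<in> kuratowski_liminf X (\<lambda>n. alpha_cut X (un n) 0)"
proof -
  obtain s where s: "\<And>n. s n \<in> sendograph X (un n)"
    and "limitin (mtopology_of (cylinder_metric X)) s (x, t) sequentially"
    using assms by (auto simp: kuratowski_liminf_def)
  then have "limitin (mtopology_of X) (\<lambda>n. fst (s n)) x sequentially"
    using limitin_sendographs_iff[of s X un, OF s] by blast
  then show ?thesis
    by (rule kuratowski_liminfI[rotated]) (rule sendograph_fst[OF s])
qed

lemma fst_limsup_sendograph:
  assumes "(x, t) \<in> kuratowski_limsup (cylinder_metric X) (\<lambda>n. sendograph X (un n))"
  shows "x \<in> kuratowski_limsup X (\<lambda>n. alpha_cut X (un n) 0)"
proof -
  obtain r s where r: "strict_mono r" and s: "\<And>j. s j \<in> sendograph X (un (r j))"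
    and "limitin (mtopology_of (cylinder_metric X)) s (x, t) sequentially"
    using assms by (auto simp: kuratowski_limsup_def)
  then have "limitin (mtopology_of X) (\<lambda>j. fst (s j)) x sequentially"
    using limitin_sendographs_iff[of s X "\<lambda>j. un (r j)", OF s] by blast
  then show ?thesis
    by (rule kuratowski_limsupI[OF r, rotated]) (rule sendograph_fst[OF s])
qed

lemma bottom_in_liminf_sendograph:
  assumes un: "\<And>n. un n \<in> fuzzy_sets X"
    and x: "x \<in> kuratowski_liminf X (\<lambda>n. alpha_cut X (un n) 0)"
  shows "(x, 0) \<in> kuratowski_liminf (cylinder_metric X) (\<lambda>n. sendograph X (un n))"
proof -
  obtain a where a: "\<And>n. a n \<in> alpha_cut X (un n) 0"
    and lim: "limitin (mtopology_of X) a x sequentially"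
    using x by (auto simp: kuratowski_liminf_def)
  have s: "(a n, 0) \<in> sendograph X (un n)" for n
    by (rule bottom_in_sendograph[OF un a])
  have "limitin (mtopology_of (cylinder_metric X)) (\<lambda>n. (a n, 0)) (x, 0) sequentially"
    using limitin_sendographs_iff[of "\<lambda>n. (a n, 0)" X un, OF s] lim by simp
  then show ?thesis
    by (rule kuratowski_liminfI[rotated]) (rule s)
qed

lemma bottom_in_limsup_sendograph:
  assumes un: "\<And>n. un n \<in> fuzzy_sets X"
    and x: "x \<in> kuratowski_limsup X (\<lambda>n. alpha_cut X (un n) 0)"
  shows "(x, 0) \<in> kuratowski_limsup (cylinder_metric X) (\<lambda>n. sendograph X (un n))"
proof -
  obtain r a where r: "strict_mono r" and a: "\<And>j. a j \<in> alpha_cut X (un (r j)) 0"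
    and lim: "limitin (mtopology_of X) a x sequentially"
    using x by (auto simp: kuratowski_limsup_def)
  have s: "(a j, 0) \<in> sendograph X (un (r j))" for j
    by (rule bottom_in_sendograph[OF un a])
  have "limitin (mtopology_of (cylinder_metric X)) (\<lambda>j. (a j, 0)) (x, 0) sequentially"
    using limitin_sendographs_iff[of "\<lambda>j. (a j, 0)" X "\<lambda>j. un (r j)", OF s] lim by simp
  then show ?thesis
    by (rule kuratowski_limsupI[OF r, rotated]) (rule s)
qed

text \<open>Since the limit has positive height, so have all but finitely many terms, and these lie in
  the sendographs. The finitely many others are replaced by arbitrary sendograph points, which
  is where nonemptiness of the \<open>0\<close>-cuts enters.\<close>

lemma pos_liminf_endograph_in_sendograph:
  assumes un: "\<And>n. un n \<in> fuzzy_sets X" and ne: "\<And>n. alpha_cut X (un n) 0 \<noteq> {}"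
    and p: "(x, t) \<in> kuratowski_liminf (cylinder_metric X) (\<lambda>n. endograph X (un n))" and t: "t > 0"
  shows "(x, t) \<in> kuratowski_liminf (cylinder_metric X) (\<lambda>n. sendograph X (un n))"
proof -
  obtain s where s: "\<And>n. s n \<in> endograph X (un n)"
    and lim: "limitin (mtopology_of (cylinder_metric X)) s (x, t) sequentially"
    using p by (auto simp: kuratowski_liminf_def)
  have "(\<lambda>n. snd (s n)) \<longlonglongrightarrow> t"
    using lim limitin_endographs_iff[of s X un, OF s] by blast
  then have pos: "\<forall>\<^sub>F n in sequentially. snd (s n) > 0"
    using t by (rule order_tendstoD(1))
  obtain w where w: "\<And>n. w n \<in> alpha_cut X (un n) 0"
    by (rule that[of "\<lambda>n. SOME a. a \<in> alpha_cut X (un n) 0"]) (simp add: some_in_eq ne)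
  define s' where "s' = (\<lambda>n. if snd (s n) > 0 then s n else (w n, 0))"
  have "\<forall>\<^sub>F n in sequentially. s n = s' n"
    using pos by eventually_elim (simp add: s'_def)
  then have "limitin (mtopology_of (cylinder_metric X)) s' (x, t) sequentially"
    using lim by (rule limitin_transform_eventually)
  moreover have "s' n \<in> sendograph X (un n)" for n
    using endograph_pos_in_sendograph[OF s] bottom_in_sendograph[OF un w] by (simp add: s'_def)
  ultimately show ?thesis
    by (intro kuratowski_liminfI)
qed

text \<open>As for the lower limit, except that the finitely many bad terms are dropped by passing to
  a tail of the subsequence.\<close>

lemma pos_limsup_endograph_in_sendograph:
  assumes p: "(x, t) \<in> kuratowski_limsup (cylinder_metric X) (\<lambda>n. endograph X (un n))" and t: "t > 0"
  shows "(x, t) \<in> kuratowski_limsup (cylinder_metric X) (\<lambda>n. sendograph X (un n))"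
proof -
  obtain r s where r: "strict_mono r" and s: "\<And>j. s j \<in> endograph X (un (r j))"
    and lim: "limitin (mtopology_of (cylinder_metric X)) s (x, t) sequentially"
    using p by (auto simp: kuratowski_limsup_def)
  have "(\<lambda>j. snd (s j)) \<longlonglongrightarrow> t"
    using lim limitin_endographs_iff[of s X "\<lambda>j. un (r j)", OF s] by blast
  then have "\<forall>\<^sub>F j in sequentially. snd (s j) > 0"
    using t by (rule order_tendstoD(1))
  then obtain N where N: "\<And>j. j \<ge> N \<Longrightarrow> snd (s j) > 0"
    by (auto simp: eventually_sequentially)
  have shift: "strict_mono (\<lambda>j. j + N)"
    by (simp add: strict_mono_def)
  have "strict_mono (r \<circ> (\<lambda>j. j + N))"
    using r shift by (rule strict_mono_o)
  moreover have "limitin (mtopology_of (cylinder_metric X)) (s \<circ> (\<lambda>j. j + N)) (x, t) sequentially"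
    using shift lim by (rule limitin_subsequence)
  moreover have "(s \<circ> (\<lambda>j. j + N)) j \<in> sendograph X (un ((r \<circ> (\<lambda>j. j + N)) j))" for j
    using endograph_pos_in_sendograph[OF s N] by simp
  ultimately show ?thesis
    by (intro kuratowski_limsupI)
qed

theorem kuratowski_sendograph_iff:
  assumes u: "u \<in> fuzzy_sets X" and un: "\<And>n. un n \<in> fuzzy_sets X"
    and ne: "\<And>n. alpha_cut X (un n) 0 \<noteq> {}"
  shows "kuratowski_converges (cylinder_metric X) (\<lambda>n. sendograph X (un n)) (sendograph X u) \<longleftrightarrow>
         gamma_converges X un u \<and>
         kuratowski_converges X (\<lambda>n. alpha_cut X (un n) 0) (alpha_cut X u 0)"
    (is "?S \<longleftrightarrow> ?G \<and> ?C")
proof (intro iffI conjI)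
  let ?Y = "cylinder_metric X"
  assume ?S
  then have inf: "sendograph X u \<subseteq> kuratowski_liminf ?Y (\<lambda>n. sendograph X (un n))"
    and sup: "kuratowski_limsup ?Y (\<lambda>n. sendograph X (un n)) \<subseteq> sendograph X u"
    by (auto simp: kuratowski_converges_iff)
  show ?G
    unfolding gamma_converges_def kuratowski_converges_iff
  proof (intro conjI subsetI; clarify)
    fix x t assume p: "(x, t) \<in> endograph X u"
    show "(x, t) \<in> kuratowski_liminf ?Y (\<lambda>n. endograph X (un n))"
    proof (cases "t > 0")
      case True
      then show ?thesis
        using p inf endograph_pos_in_sendograph[OF p] liminf_sendograph_subset_endograph by fastforce
    next
      case False
      with p have x: "x \<in> mspace X" and [simp]: "t = 0"
        by (auto simp: endograph_def)
      have "limitin (mtopology_of ?Y) (\<lambda>n. (x, 0)) (x, 0) sequentially"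
        using x by (simp add: limitin_const)
      then show ?thesis
        using bottom_in_endograph[OF un x] \<open>t = 0\<close>
        by (intro kuratowski_liminfI[of "\<lambda>n. (x, 0)"]) simp_all
    qed
  next
    fix x t assume p: "(x, t) \<in> kuratowski_limsup ?Y (\<lambda>n. endograph X (un n))"
    then have "(x, t) \<in> mspace ?Y"
      by (auto simp: kuratowski_limsup_def limitin_mtopology_of_dist_null)
    then have x: "x \<in> mspace X" and "t \<ge> 0" by auto
    then consider "t > 0" | "t = 0" by linarith
    then show "(x, t) \<in> endograph X u"
    proof cases
      case 1
      then show ?thesis
        using pos_limsup_endograph_in_sendograph[OF p] sup sendograph_subset_endograph by blast
    next
      case 2
      then show ?thesis using bottom_in_endograph[OF u x] by simp
    qed
  qed
  show ?C
    unfolding kuratowski_converges_iff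
  proof (intro conjI subsetI)
    fix x assume "x \<in> alpha_cut X u 0"
    then show "x \<in> kuratowski_liminf X (\<lambda>n. alpha_cut X (un n) 0)"
      by (intro fst_liminf_sendograph[of x 0] subsetD[OF inf] bottom_in_sendograph[OF u])
  next
    fix x assume "x \<in> kuratowski_limsup X (\<lambda>n. alpha_cut X (un n) 0)"
    then have "(x, 0) \<in> sendograph X u"
      by (intro subsetD[OF sup] bottom_in_limsup_sendograph[OF un])
    then show "x \<in> alpha_cut X u 0"
      by (auto dest: sendograph_fst)
  qed
next
  let ?Y = "cylinder_metric X"
  assume GC: "?G \<and> ?C"
  show ?S
    unfolding kuratowski_converges_iff
  proof (intro conjI subsetI; clarify)
    fix x t assume p: "(x, t) \<in> sendograph X u"
    then have "t \<ge> 0" and x: "x \<in> alpha_cut X u 0"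
      by (auto simp: sendograph_def)
    then consider "t > 0" | "t = 0" by linarith
    then show "(x, t) \<in> kuratowski_liminf ?Y (\<lambda>n. sendograph X (un n))"
    proof cases
      case 1
      have "(x, t) \<in> kuratowski_liminf ?Y (\<lambda>n. endograph X (un n))"
        using p GC sendograph_subset_endograph
        unfolding gamma_converges_def kuratowski_converges_iff by blast
      then show ?thesis
        using 1 by (rule pos_liminf_endograph_in_sendograph[OF un ne])
    next
      case 2
      have "x \<in> kuratowski_liminf X (\<lambda>n. alpha_cut X (un n) 0)"
        using x GC unfolding kuratowski_converges_iff by blast
      then show ?thesis
        unfolding 2 by (rule bottom_in_liminf_sendograph[OF un])
    qed
  next
    fix x t assume p: "(x, t) \<in> kuratowski_limsup ?Y (\<lambda>n. sendograph X (un n))"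
    have "(x, t) \<in> endograph X u"
      using p GC limsup_sendograph_subset_endograph
      unfolding gamma_converges_def kuratowski_converges_iff by blast
    moreover have "x \<in> alpha_cut X u 0"
      using fst_limsup_sendograph[OF p] GC unfolding kuratowski_converges_iff by blast
    ultimately show "(x, t) \<in> sendograph X u"
      by (auto simp: sendograph_def endograph_def)
  qed
qed

section \<open>Sendograph convergence\<close>

theorem proposition3p3:
  fixes X :: "'a metric"
    and u :: "'a \<Rightarrow> real"
    and un :: "nat \<Rightarrow> 'a \<Rightarrow> real"
  assumes "mspace X \<noteq> {}"
    and "u \<in> F1_USC X"
    and "\<And>n. un n \<in> F1_USC X"
  shows "(((\<lambda>n. H_send X (un n) u) \<longlonglongrightarrow> 0) \<longleftrightarrow>
            ((\<lambda>n. H_end X (un n) u) \<longlonglongrightarrow> 0) \<and>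
            ((\<lambda>n. hausdorff_edist X (alpha_cut X (un n) 0) (alpha_cut X u 0)) \<longlonglongrightarrow> 0)) \<and>
         (kuratowski_converges (cylinder_metric X) (\<lambda>n. sendograph X (un n)) (sendograph X u) \<longleftrightarrow>
            gamma_converges X un u \<and>
            kuratowski_converges X (\<lambda>n. alpha_cut X (un n) 0) (alpha_cut X u 0))"
proof -
  have u: "u \<in> fuzzy_sets X" and un: "\<And>n. un n \<in> fuzzy_sets X"
    and ne: "\<And>n. alpha_cut X (un n) 0 \<noteq> {}"
    using assms by (auto simp: F1_USC_def)
  show ?thesis
    using H_send_tendsto_0_iff[OF u un] kuratowski_sendograph_iff[OF u un ne] by (rule conjI)
qed

end
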